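(* Let $A,B\in\widehat{\mathbb Q}^{m\times m}$. If both $A$ and $B$ are Hermitian matrices, then $$\|\lambda(A)-\lambda(B)\|_2\le\|A-B\|_F,$$ where $\lambda(A)=(\lambda_1(A),\ldots,\lambda_m(A))^\top$ and $\lambda(B)=(\lambda_1(B),\ldots,\lambda_m(B))^\top$, with $\lambda_1(A)\ge\lambda_2(A)\ge\cdots\ge\lambda_m(A)$ and $\lambda_1(B)\ge\lambda_2(B)\ge\cdots\ge\lambda_m(B)$ being the eigenvalues of $A$ and $B$, respectively, and $\le$ is the total order on dual numbers.
   Context: Dual numbers: $\widehat{\mathbb R}=\{q_{\sf st}+q_{\sf in}\epsilon: q_{\sf st},q_{\sf in}\in\mathbb R\}$ with $\epsilon\neq 0$, $\epsilon^2=0$, is a commutative ring, totally ordered by: $q<p$ iff $q_{\sf st}<p_{\sf st}$, or $q_{\sf st}=p_{\sf st}$ and $q_{\sf in}<p_{\sf in}$. For a positive appreciable dual number $q$ (i.e. $q_{\sf st}>0$), $\sqrt q=\sqrt{q_{\sf st}}+\frac{q_{\sf in}}{2\sqrt{q_{\sf st}}}\epsilon$; also $\sqrt 0=0$. Dual quaternions: let $\mathbb Q$ be the real quaternions. $\widehat{\mathbb Q}=\{q_{\sf st}+q_{\sf in}\epsilon: q_{\sf st},q_{\sf in}\in\mathbb Q\}$, where $\epsilon$ commutes with quaternions and $\epsilon^2=0$. The conjugate is $\bar q=\bar q_{\sf st}+\bar q_{\sf in}\epsilon$. The magnitude of $q$ is the dual number $|q|=|q_{\sf st}|+\frac{q_{\sf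 st}\bar q_{\sf in}+q_{\sf in}\bar q_{\sf st}}{2|q_{\sf st}|}\epsilon$ if $q_{\sf st}\ne0$, and $|q|=|q_{\sf in}|\epsilon$ otherwise. Matrices: $A=(a_{ij})\in\widehat{\mathbb Q}^{m\times n}$ is written $A=A_{\sf st}+A_{\sf in}\epsilon$ with $A_{\sf st},A_{\sf in}\in\mathbb Q^{m\times n}$; $A$ is appreciable if $A_{\sf st}\ne O$ and infinitesimal otherwise (likewise for vectors). $A^*=(\bar a_{ji})$. A square matrix is Hermitian if $A^*=A$; a square matrix $U$ is unitary if $U^*U=UU^*=I$. The Frobenius norm is the dual number $\|A\|_F=\sqrt{\sum_{i,j}|a_{ij}|^2}$ if $A_{\sf st}\neq O$, and $\|A\|_F=\|A_{\sf in}\|_F\,\epsilon$ otherwise, where $\|A_{\sf in}\|_F$ is the usual Frobenius norm of a quaternion matrix. For a vector $\mathbf x$ (with dual quaternion, in particular dual number, entries), $\|\mathbf x\|_2$ is its Frobenius norm as a one-column matrix. Eigenvalues: $\lambda\in\widehat{\mathbb Q}$ is a right eigenvalue of $A\in\widehat{\mathbb Q}^{m\times m}$ if $A\mathbf x=\mathbf x\lambda$ for some appreciable $\mathbf x\in\widehat{\mathbb Q}^m$; if $\lambda$ is a dual number it is simply called an eigenvalue. It is known that for Hermitian $A\in\widehat{\mathbb Q}^{m\times m}$ there is a unitary $U\in\widehat{\mathbb Q}^{m\times m}$ with $A=U\,\mathrm{diag}(\lambda_1(A),\dots,\lambda_m(A))\,U^*$, where $\lambda_1(A)\ge\cdots\ge\lambda_m(A)$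 are dual numbers uniquely determined by $A$ (with multiplicity); these are the $m$ eigenvalues of $A$. *)

theory Defs
  imports "HOL-Analysis.Analysis"
begin

section \<open>Dual numbers over a ring\<close>

text \<open>
  \<open>Dual a b\<close> is \<open>a + b \<epsilon>\<close>, where \<open>\<epsilon>\<close> commutes with all coefficients and \<open>\<epsilon>\<^sup>2 = 0\<close>.
  The dual numbers are \<open>real dual\<close>, the dual quaternions (over the type \<open>quat\<close> below) are
  \<open>quat dual\<close>.
\<close>

datatype 'a dual = Dual (std: 'a) (infi: 'a)

lemma dual_eq_iff: "p = q \<longleftrightarrow> std p = std q \<and> infi p = infi q"
  by (cases p; cases q) simp

instantiation dual :: (ab_group_add) ab_group_add
begin

definition zero_dual :: "'a dual" where "0 = Dual 0 0"

definition plus_dual :: "'a dual \<Rightarrow> 'a dual \<Rightarrow> 'a dual"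
  where "p + q = Dual (std p + std q) (infi p + infi q)"

definition minus_dual :: "'a dual \<Rightarrow> 'a dual \<Rightarrow> 'a dual"
  where "p - q = Dual (std p - std q) (infi p - infi q)"

definition uminus_dual :: "'a dual \<Rightarrow> 'a dual"
  where "- p = Dual (- std p) (- infi p)"

instance
  by standard
    (simp_all add: dual_eq_iff zero_dual_def plus_dual_def minus_dual_def uminus_dual_def
      algebra_simps)

end

instantiation dual :: (ring_1) ring_1
begin

definition one_dual :: "'a dual" where "1 = Dual 1 0"

definition times_dual :: "'a dual \<Rightarrow> 'a dual \<Rightarrow> 'a dual"
  where "p * q = Dual (std p * std q) (std p * infi q + infi p * std q)"

instance
  by standard
    (simp_all add: dual_eq_iff zero_dual_def plus_dual_def one_dual_def times_dual_def
      algebra_simps)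

end

instance dual :: (comm_ring_1) comm_ring_1
proof
  fix p q :: "'a dual"
  show "p * q = q * p"
    by (simp add: times_dual_def mult.commute add.commute)
qed (rule mult_1_left distrib_right)+

instantiation dual :: (linorder) linorder
begin

definition less_dual :: "'a dual \<Rightarrow> 'a dual \<Rightarrow> bool"
  where "p < q \<longleftrightarrow> std p < std q \<or> (std p = std q \<and> infi p < infi q)"

definition less_eq_dual :: "'a dual \<Rightarrow> 'a dual \<Rightarrow> bool"
  where "p \<le> q \<longleftrightarrow> p < q \<or> p = q" for p q :: "'a dual"

instance
proof
  have le: "p \<le> q \<longleftrightarrow> std p < std q \<or> (std p = std q \<and> infi p \<le> infi q)"
    for p q :: "'a dual"
    unfolding less_eq_dual_def less_dual_def dual_eq_iff order.order_iff_strict by blast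
  fix p q r :: "'a dual"
  show "p < q \<longleftrightarrow> p \<le> q \<and> \<not> q \<le> p"
    unfolding le less_dual_def by (cases "std p" "std q" rule: linorder_cases) auto
  show "p \<le> p"
    unfolding le by simp
  show "p \<le> q \<Longrightarrow> q \<le> r \<Longrightarrow> p \<le> r"
    unfolding le by (elim disjE conjE) auto
  show "p \<le> q \<Longrightarrow> q \<le> p \<Longrightarrow> p = q"
    unfolding le dual_eq_iff by (cases "std p" "std q" rule: linorder_cases) auto
  show "p \<le> q \<or> q \<le> p"
    unfolding le by (cases "std p" "std q" rule: linorder_cases) auto
qed

end

text \<open>
  Only positive appreciable dual numbers and \<open>0\<close> have a square root in the sense used here;
  the value \<open>0\<close> on all other arguments is a convention.
\<close>

definition dual_sqrt :: "real dual \<Rightarrow> real dual"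
  where "dual_sqrt q =
    (if std q > 0 then Dual (sqrt (std q)) (infi q / (2 * sqrt (std q))) else 0)"


section \<open>Quaternions and dual quaternions\<close>

datatype quat = Quat (qre: real) (qi: real) (qj: real) (qk: real)

lemma quat_eq_iff:
  "x = y \<longleftrightarrow> qre x = qre y \<and> qi x = qi y \<and> qj x = qj y \<and> qk x = qk y"
  by (cases x; cases y) simp

instantiation quat :: ring_1
begin

definition zero_quat :: quat where "0 = Quat 0 0 0 0"

definition one_quat :: quat where "1 = Quat 1 0 0 0"

definition plus_quat :: "quat \<Rightarrow> quat \<Rightarrow> quat"
  where "x + y = Quat (qre x + qre y) (qi x + qi y) (qj x + qj y) (qk x + qk y)"

definition minus_quat :: "quat \<Rightarrow> quat \<Rightarrow> quat"
  where "x - y = Quat (qre x - qre y) (qi x - qi y) (qj x - qj y) (qk x - qk y)"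

definition uminus_quat :: "quat \<Rightarrow> quat"
  where "- x = Quat (- qre x) (- qi x) (- qj x) (- qk x)"

definition times_quat :: "quat \<Rightarrow> quat \<Rightarrow> quat"
  where "x * y = Quat
    (qre x * qre y - qi x * qi y - qj x * qj y - qk x * qk y)
    (qre x * qi y + qi x * qre y + qj x * qk y - qk x * qj y)
    (qre x * qj y - qi x * qk y + qj x * qre y + qk x * qi y)
    (qre x * qk y + qi x * qj y - qj x * qi y + qk x * qre y)"

instance
  by standard
    (simp_all add: quat_eq_iff zero_quat_def one_quat_def plus_quat_def minus_quat_def
      uminus_quat_def times_quat_def algebra_simps)

end

definition quat_of_real :: "real \<Rightarrow> quat"
  where "quat_of_real r = Quat r 0 0 0"

definition quat_cnj :: "quat \<Rightarrow> quat"
  where "quat_cnj x = Quat (qre x) (- qi x) (- qj x) (- qk x)"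

definition quat_abs :: "quat \<Rightarrow> real"
  where "quat_abs x = sqrt ((qre x)\<^sup>2 + (qi x)\<^sup>2 + (qj x)\<^sup>2 + (qk x)\<^sup>2)"

definition dq_of_dual :: "real dual \<Rightarrow> quat dual"
  where "dq_of_dual q = Dual (quat_of_real (std q)) (quat_of_real (infi q))"

definition dq_cnj :: "quat dual \<Rightarrow> quat dual"
  where "dq_cnj q = Dual (quat_cnj (std q)) (quat_cnj (infi q))"

text \<open>The numerator in the infinitesimal part of the magnitude is a real quaternion:\<close>

lemma quat_cross_term_real:
  "x * quat_cnj y + y * quat_cnj x = quat_of_real (qre (x * quat_cnj y + y * quat_cnj x))"
  by (simp add: quat_eq_iff times_quat_def plus_quat_def quat_cnj_def quat_of_real_def)

definition dq_abs :: "quat dual \<Rightarrow> real dual"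
  where "dq_abs q =
    (if std q \<noteq> 0
     then Dual (quat_abs (std q))
       (qre (std q * quat_cnj (infi q) + infi q * quat_cnj (std q)) / (2 * quat_abs (std q)))
     else Dual 0 (quat_abs (infi q)))"


section \<open>Matrices and norms\<close>

definition mat_std :: "'a dual^'n^'m \<Rightarrow> 'a^'n^'m"
  where "mat_std A = (\<chi> i j. std (A $ i $ j))"

definition mat_infi :: "'a dual^'n^'m \<Rightarrow> 'a^'n^'m"
  where "mat_infi A = (\<chi> i j. infi (A $ i $ j))"

definition adjoint_mat :: "quat dual^'n^'m \<Rightarrow> quat dual^'m^'n"
  where "adjoint_mat A = (\<chi> i j. dq_cnj (A $ j $ i))"

definition hermitian :: "quat dual^'m^'m \<Rightarrow> bool"
  where "hermitian A \<longleftrightarrow> adjoint_mat A = A"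

definition unitary :: "quat dual^'m^'m \<Rightarrow> bool"
  where "unitary U \<longleftrightarrow> adjoint_mat U ** U = mat 1 \<and> U ** adjoint_mat U = mat 1"

definition quat_frob_norm :: "quat^'n^'m \<Rightarrow> real"
  where "quat_frob_norm A = sqrt (\<Sum>i\<in>UNIV. \<Sum>j\<in>UNIV. (quat_abs (A $ i $ j))\<^sup>2)"

definition frob_norm :: "quat dual^'n^'m \<Rightarrow> real dual"
  where "frob_norm A =
    (if mat_std A \<noteq> 0
     then dual_sqrt (\<Sum>i\<in>UNIV. \<Sum>j\<in>UNIV. (dq_abs (A $ i $ j))\<^sup>2)
     else Dual 0 (quat_frob_norm (mat_infi A)))"

definition vec_norm2 :: "quat dual^'m \<Rightarrow> real dual"
  where "vec_norm2 x = frob_norm (\<chi> i (j::1). x $ i)"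

definition dual_vec_norm2 :: "real dual^'m \<Rightarrow> real dual"
  where "dual_vec_norm2 x = vec_norm2 (\<chi> i. dq_of_dual (x $ i))"


section \<open>Eigenvalues\<close>

text \<open>
  An index type of class \<open>{finite, linorder}\<close> with \<open>m\<close> elements is order isomorphic to
  \<open>{1, \<dots>, m}\<close>; the order is needed to say that the eigenvalues are listed decreasingly.
\<close>

definition diag_mat :: "real dual^'m \<Rightarrow> quat dual^'m^'m"
  where "diag_mat l = (\<chi> i j. if i = j then dq_of_dual (l $ i) else 0)"

definition is_eigenvalue_vector ::
    "quat dual^'m::{finite,linorder}^'m::{finite,linorder}
      \<Rightarrow> real dual^'m::{finite,linorder} \<Rightarrow> bool"
  where "is_eigenvalue_vector A l \<longleftrightarrow>
    (\<forall>i j. i \<le> j \<longrightarrow> l $ j \<le> l $ i) \<and>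
    (\<exists>U. unitary U \<and> A = U ** diag_mat l ** adjoint_mat U)"

text \<open>
  By the spectral theorem a Hermitian \<open>A\<close> has exactly one such vector; for other matrices
  the value below is meaningless.
\<close>

definition eigenvalue_vector ::
    "quat dual^'m::{finite,linorder}^'m::{finite,linorder}
      \<Rightarrow> real dual^'m::{finite,linorder}"
  where "eigenvalue_vector A = (THE l. is_eigenvalue_vector A l)"

text \<open>
  The entries of an eigenvalue vector are right eigenvalues of the matrix. They are counted
  with multiplicity, which is why the vector is defined by a diagonalization and not from
  the set of right eigenvalues.
\<close>

definition right_eigenvalue :: "quat dual^'m^'m \<Rightarrow> quat dual \<Rightarrow> bool"
  where "right_eigenvalue A q \<longleftrightarrow>
    (\<exists>x. (\<exists>i. std (x $ i) \<noteq> 0) \<and> A *v x = (\<chi> i. x $ i * q))"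

lemma std_sum: "std (sum f S) = (\<Sum>i\<in>S. std (f i))" for f :: "'b \<Rightarrow> 'a::ab_group_add dual"
  by (induction S rule: infinite_finite_induct) (simp_all add: zero_dual_def plus_dual_def)

lemma right_eigenvalue_if_is_eigenvalue_vector:
  fixes A :: "quat dual^'m::{finite,linorder}^'m::{finite,linorder}"
  assumes "is_eigenvalue_vector A l"
  shows "right_eigenvalue A (dq_of_dual (l $ k))"
proof -
  obtain U where U: "unitary U" and A: "A = U ** diag_mat l ** adjoint_mat U"
    using assms by (auto simp: is_eigenvalue_vector_def)
  have AU: "A ** U = U ** diag_mat l"
    using U by (simp add: A unitary_def flip: matrix_mul_assoc)
  define x where "x = (\<chi> i. U $ i $ k)"
  have "A *v x = (\<chi> i. (A ** U) $ i $ k)"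
    by (simp add: vec_eq_iff matrix_vector_mult_def matrix_matrix_mult_def x_def)
  also have "\<dots> = (\<chi> i. x $ i * dq_of_dual (l $ k))"
    unfolding AU
    by (simp add: vec_eq_iff matrix_matrix_mult_def diag_mat_def x_def if_distrib
        cong: if_cong)
  finally have Ax: "A *v x = (\<chi> i. x $ i * dq_of_dual (l $ k))" .
  have "\<exists>i. std (x $ i) \<noteq> 0"
  proof (rule ccontr)
    assume "\<not> ?thesis"
    then have z: "std (U $ i $ k) = 0" for i
      by (simp add: x_def)
    have "(adjoint_mat U ** U) $ k $ k = 1"
      using U by (simp add: unitary_def mat_def)
    then have "std (\<Sum>i\<in>UNIV. dq_cnj (U $ i $ k) * U $ i $ k) = 1"
      by (simp add: matrix_matrix_mult_def adjoint_mat_def one_dual_def)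
    then show False
      by (simp add: std_sum times_dual_def z)
  qed
  with Ax show ?thesis
    by (auto simp: right_eigenvalue_def)
qed

end

theory Submission
  imports Defs
begin

text \<open>
  The inequality is the Hoffman--Wielandt inequality over the dual numbers. Write
  \<open>A = U diag(l) U\<^sup>*\<close> and \<open>B = V diag(m) V\<^sup>*\<close> with decreasing \<open>l\<close>, \<open>m\<close>, and put
  \<open>W = U\<^sup>* V\<close>. The sum of the squared magnitudes of the entries is unitarily invariant, and the
  entries of \<open>U\<^sup>* (A - B) V\<close> are \<open>(l\<^sub>i - m\<^sub>j) w\<^sub>i\<^sub>j\<close>, so the squared Frobenius norm of \<open>A - B\<close>
  is the sum of \<open>(l\<^sub>i - m\<^sub>j)\<^sup>2 |w\<^sub>i\<^sub>j|\<^sup>2\<close>. The weights \<open>|w\<^sub>i\<^sub>j|\<^sup>2\<close> are nonnegative and doubly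
  stochastic, and the dual numbers are a totally ordered ring, in which the rearrangement
  inequality \<open>doubly_stochastic_diff_squares\<close> holds as it does over the reals.

  Squares do not see infinitesimals. If \<open>A - B\<close> is infinitesimal, the above only shows that
  \<open>l\<close> and \<open>m\<close> have the same standard part. Then \<open>W\<close> has a block diagonal standard part, with
  blocks given by the equal standard parts of the eigenvalues. Within each block the
  infinitesimal parts of \<open>l\<close> and \<open>m\<close> are decreasing, and the rearrangement inequality, now for
  real numbers and block by block, gives the bound (\<open>hoffman_wielandt_diagonalized\<close>).

  The eigenvalue vector is defined by a unique description, so it also has to be shown that
  exactly one exists. Uniqueness is the inequality for \<open>A = B\<close>. For existence
  (\<open>eigenvalue_vector_exists\<close>), a quaternion unitary matrix is chosen that maximizes a weighted
  trace of the conjugated standard part of \<open>A\<close> and, among the maximizers, that of the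
  infinitesimal part. Plane rotations show that it diagonalizes the standard part, and the
  infinitesimal part within each block of equal eigenvalues. The entries outside the blocks are
  removed by a unitary matrix that differs from the identity by an infinitesimal.
\<close>

section \<open>The ordered ring of dual numbers\<close>

lemma dual_le_iff:
  "p \<le> q \<longleftrightarrow> std p < std q \<or> (std p = std q \<and> infi p \<le> infi q)"
  for p q :: "'a::linorder dual"
  unfolding less_eq_dual_def less_dual_def dual_eq_iff order.order_iff_strict by blast

lemma dual_components [simp]:
  "std (0::'a::ab_group_add dual) = 0" "infi (0::'a dual) = 0"
  "std (p + q) = std p + std q" "infi (p + q) = infi p + infi q"
  "std (p - q) = std p - std q" "infi (p - q) = infi p - infi q"
  "std (- p) = - std p" "infi (- p) = - infi p"
  for p q :: "'a::ab_group_add dual"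
  by (simp_all add: zero_dual_def plus_dual_def minus_dual_def uminus_dual_def)

lemma dual_mult_components [simp]:
  "std (1::'a::ring_1 dual) = 1" "infi (1::'a dual) = 0"
  "std (x * y) = std x * std y" "infi (x * y) = std x * infi y + infi x * std y"
  for x y :: "'a::ring_1 dual"
  by (simp_all add: one_dual_def times_dual_def)

lemma infi_sum: "infi (sum f S) = (\<Sum>i\<in>S. infi (f i))" for f :: "'b \<Rightarrow> 'a::ab_group_add dual"
  by (induction S rule: infinite_finite_induct) simp_all

text \<open>
  Multiplication by a nonnegative infinitesimal sees only the standard part of the other factor;
  it is monotone since the standard part is.
\<close>

instance dual :: (linordered_idom) ordered_comm_ring
proof
  fix a b c :: "'a dual"
  show "a \<le> b \<Longrightarrow> c + a \<le> c + b"
    by (auto simp: dual_le_iff)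
  show "a \<le> b \<Longrightarrow> 0 \<le> c \<Longrightarrow> c * a \<le> c * b"
    by (auto simp: dual_le_iff mult_left_mono mult_strict_left_mono)
qed

section \<open>Doubly stochastic weights and monotone sequences\<close>

lemma exists_between_finite_sets:
  fixes X Y :: "'a::linorder set"
  assumes "finite X" "finite Y" and "\<And>x y. x \<in> X \<Longrightarrow> y \<in> Y \<Longrightarrow> x \<le> y"
  shows "\<exists>c. (\<forall>x\<in>X. x \<le> c) \<and> (\<forall>y\<in>Y. c \<le> y)"
proof (cases "X = {}")
  case True
  show ?thesis
  proof (cases "Y = {}")
    case False
    with True assms(2) show ?thesis
      by (intro exI[of _ "Min Y"]) simp
  qed (simp add: True)
next
  case False
  with assms show ?thesis
    by (intro exI[of _ "Max X"]) simp
qed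

text \<open>
  These potentials are a dual certificate for the assignment problem with payoffs
  \<open>l i * m j\<close>: they show that, for decreasing \<open>l\<close> and \<open>m\<close>, the identity assignment is optimal.
  They are found by adding the indices in increasing order. A new index \<open>k\<close> only asks for a
  value \<open>v k\<close> between finitely many lower and upper bounds, and these are compatible because
  \<open>(l i - l k) * (m j - m k) \<ge> 0\<close>.
  The labelling \<open>b\<close> splits the indices into blocks; monotonicity is only needed within a block
  if assignments across blocks are excluded.
\<close>

lemma block_potentials:
  fixes l m :: "'i::linorder \<Rightarrow> 'a::{linorder,ordered_comm_ring}" and b :: "'i \<Rightarrow> 'b"
  assumes "finite S"
    and l: "\<And>i j. i \<le> j \<Longrightarrow> b i = b j \<Longrightarrow> l j \<le> l i"
    and m: "\<And>i j. i \<le> j \<Longrightarrow> b i = b j \<Longrightarrow> m j \<le> m i"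
  shows "\<exists>u v. (\<forall>i\<in>S. u i + v i = l i * m i) \<and>
    (\<forall>i\<in>S. \<forall>j\<in>S. b i = b j \<longrightarrow> l i * m j \<le> u i + v j)"
  using \<open>finite S\<close>
proof (induction rule: finite_linorder_max_induct)
  case empty
  show ?case by simp
next
  case (insert k S)
  from insert.IH obtain u v where
    eq: "\<And>i. i \<in> S \<Longrightarrow> u i + v i = l i * m i" and
    le: "\<And>i j. i \<in> S \<Longrightarrow> j \<in> S \<Longrightarrow> b i = b j \<Longrightarrow> l i * m j \<le> u i + v j"
    by blast
  define T where "T = {i \<in> S. b i = b k}"
  have "\<exists>c. (\<forall>x\<in>(\<lambda>i. l i * m k - u i) ` T. x \<le> c) \<and>
      (\<forall>y\<in>(\<lambda>j. l k * m k - l k * m j + v j) ` T. c \<le> y)"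
  proof (rule exists_between_finite_sets)
    fix x y
    assume "x \<in> (\<lambda>i. l i * m k - u i) ` T" "y \<in> (\<lambda>j. l k * m k - l k * m j + v j) ` T"
    then obtain i j where ij: "i \<in> S" "b i = b k" "j \<in> S" "b j = b k"
      and x: "x = l i * m k - u i" and y: "y = l k * m k - l k * m j + v j"
      by (auto simp: T_def)
    have "0 \<le> (l i - l k) * (m j - m k)"
      using ij insert.hyps l[of i k] m[of j k] by (intro mult_nonneg_nonneg) (auto intro: less_imp_le)
    moreover have "0 \<le> u i + v j - l i * m j"
      using le[of i j] ij by simp
    ultimately have "0 \<le> (l i - l k) * (m j - m k) + (u i + v j - l i * m j)"
      by (rule add_nonneg_nonneg)
    also have "\<dots> = y - x"
      by (simp add: x y algebra_simps)
    finally show "x \<le> y" by simp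
  qed (use insert.hyps in \<open>auto simp: T_def\<close>)
  then obtain c where
    lower: "\<And>i. i \<in> S \<Longrightarrow> b i = b k \<Longrightarrow> l i * m k - u i \<le> c" and
    upper: "\<And>j. j \<in> S \<Longrightarrow> b j = b k \<Longrightarrow> c \<le> l k * m k - l k * m j + v j"
    by (auto simp: T_def)
  have k: "k \<notin> S" using insert.hyps by blast
  define u' where "u' = u(k := l k * m k - c)"
  define v' where "v' = v(k := c)"
  have "u' i + v' i = l i * m i" if "i \<in> insert k S" for i
    using that eq k by (auto simp: u'_def v'_def)
  moreover have "l i * m j \<le> u' i + v' j"
    if "i \<in> insert k S" "j \<in> insert k S" "b i = b j" for i j
    using that le[of i j] lower[of i] upper[of j] k
    by (auto simp: u'_def v'_def algebra_simps)
  ultimately show ?case by blast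
qed

text \<open>
  Expanding the squares, everything but the mixed terms \<open>l i * m j\<close> agrees on both sides, since
  the weights have row and column sums \<open>1\<close>. The mixed terms are bounded by potentials, whose
  weighted sum does not depend on the weights.
\<close>

lemma doubly_stochastic_diff_squares:
  fixes l m :: "'i::{finite,linorder} \<Rightarrow> 'a::{linorder,ordered_comm_ring,comm_ring_1}"
    and P :: "'i \<Rightarrow> 'i \<Rightarrow> 'a" and b :: "'i \<Rightarrow> 'b"
  assumes l: "\<And>i j. i \<le> j \<Longrightarrow> b i = b j \<Longrightarrow> l j \<le> l i"
    and m: "\<And>i j. i \<le> j \<Longrightarrow> b i = b j \<Longrightarrow> m j \<le> m i"
    and P: "\<And>i j. 0 \<le> P i j" "\<And>i j. b i \<noteq> b j \<Longrightarrow> P i j = 0"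
    and row: "\<And>i. (\<Sum>j\<in>UNIV. P i j) = 1" and col: "\<And>j. (\<Sum>i\<in>UNIV. P i j) = 1"
  shows "(\<Sum>i\<in>UNIV. (l i - m i)\<^sup>2) \<le> (\<Sum>i\<in>UNIV. \<Sum>j\<in>UNIV. (l i - m j)\<^sup>2 * P i j)"
proof -
  obtain u v where eq: "\<And>i. u i + v i = l i * m i"
    and le: "\<And>i j. b i = b j \<Longrightarrow> l i * m j \<le> u i + v j"
    using block_potentials[of UNIV b l m] l m by auto
  have weighted: "(\<Sum>i\<in>UNIV. \<Sum>j\<in>UNIV. (f i + g j) * P i j) = (\<Sum>i\<in>UNIV. f i + g i)" for f g
  proof -
    have "(\<Sum>i\<in>UNIV. \<Sum>j\<in>UNIV. (f i + g j) * P i j) =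
        (\<Sum>i\<in>UNIV. \<Sum>j\<in>UNIV. f i * P i j) + (\<Sum>i\<in>UNIV. \<Sum>j\<in>UNIV. g j * P i j)"
      by (simp add: distrib_right sum.distrib)
    also have "(\<Sum>i\<in>UNIV. \<Sum>j\<in>UNIV. g j * P i j) = (\<Sum>j\<in>UNIV. \<Sum>i\<in>UNIV. g j * P i j)"
      by (rule sum.swap)
    finally show ?thesis
      by (simp add: row col sum.distrib flip: sum_distrib_left)
  qed
  have "(\<Sum>i\<in>UNIV. (l i - m i)\<^sup>2) =
      (\<Sum>i\<in>UNIV. ((l i)\<^sup>2 - 2 * u i) + ((m i)\<^sup>2 - 2 * v i))"
  proof (rule sum.cong)
    fix i
    have "(l i - m i)\<^sup>2 = (l i)\<^sup>2 + (m i)\<^sup>2 - 2 * (l i * m i)"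
      by (simp add: power2_eq_square algebra_simps)
    then show "(l i - m i)\<^sup>2 = ((l i)\<^sup>2 - 2 * u i) + ((m i)\<^sup>2 - 2 * v i)"
      unfolding eq[symmetric] by (simp add: algebra_simps)
  qed simp
  also have "\<dots> = (\<Sum>i\<in>UNIV. \<Sum>j\<in>UNIV. (((l i)\<^sup>2 - 2 * u i) + ((m j)\<^sup>2 - 2 * v j)) * P i j)"
    by (rule weighted[symmetric])
  also have "\<dots> \<le> (\<Sum>i\<in>UNIV. \<Sum>j\<in>UNIV. (l i - m j)\<^sup>2 * P i j)"
  proof (intro sum_mono)
    fix i j
    show "(((l i)\<^sup>2 - 2 * u i) + ((m j)\<^sup>2 - 2 * v j)) * P i j \<le> (l i - m j)\<^sup>2 * P i j"
    proof (cases "b i = b j")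
      case True
      have "l i * m j + l i * m j \<le> (u i + v j) + (u i + v j)"
        using le[OF True] by (intro add_mono)
      then have "0 \<le> ((u i + v j) + (u i + v j)) - (l i * m j + l i * m j)"
        by simp
      also have "\<dots> = (l i - m j)\<^sup>2 - (((l i)\<^sup>2 - 2 * u i) + ((m j)\<^sup>2 - 2 * v j))"
        by (simp add: power2_eq_square algebra_simps)
      finally show ?thesis
        using P(1) by (intro mult_right_mono) simp_all
    qed (simp add: P(2))
  qed
  finally show ?thesis .
qed

section \<open>Unitary matrices over rings with involution\<close>

text \<open>
  Quaternions and dual quaternions are treated alike, since the argument needs unitary matrices
  over both. The law \<open>cj x * x = x * cj x\<close> makes the sum of the squared magnitudes of the
  entries of a matrix the same for the matrix and its adjoint.
\<close>

class star_ring = ring_1 +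
  fixes cj :: "'a \<Rightarrow> 'a"
  assumes cj_add: "cj (x + y) = cj x + cj y"
    and cj_mult: "cj (x * y) = cj y * cj x"
    and cj_cj [simp]: "cj (cj x) = x"
    and cj_normal: "cj x * x = x * cj x"
begin

lemma cj_0 [simp]: "cj 0 = 0"
  using cj_add[of 0 0] by simp

lemma cj_1 [simp]: "cj 1 = 1"
  using cj_mult[of "cj 1" 1] by simp

lemma cj_minus: "cj (- x) = - cj x"
  using cj_add[of x "- x"] by (simp add: eq_neg_iff_add_eq_0 add.commute)

lemma cj_sum: "cj (sum f S) = (\<Sum>i\<in>S. cj (f i))"
  by (induction S rule: infinite_finite_induct) (simp_all add: cj_add)

end

instantiation quat :: star_ring
begin

definition cj_quat :: "quat \<Rightarrow> quat" where "cj x = quat_cnj x"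

instance
  by standard (simp_all add: cj_quat_def quat_cnj_def quat_eq_iff plus_quat_def times_quat_def)

end

instantiation dual :: (star_ring) star_ring
begin

definition cj_dual :: "'a dual \<Rightarrow> 'a dual" where "cj p = Dual (cj (std p)) (cj (infi p))"

instance
proof
  fix x y :: "'a dual"
  show "cj x * x = x * cj x"
    using cj_normal[of "std x + infi x"]
    by (simp add: cj_dual_def dual_eq_iff cj_add cj_normal algebra_simps)
qed (simp_all add: cj_dual_def dual_eq_iff cj_add cj_mult add.commute)

end

lemma dq_cnj_eq_cj: "dq_cnj = cj"
  by (simp add: fun_eq_iff dq_cnj_def cj_dual_def cj_quat_def)

definition adj :: "'a::star_ring^'n^'m \<Rightarrow> 'a^'m^'n"
  where "adj A = (\<chi> i j. cj (A $ j $ i))"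

definition star_unitary :: "'a::star_ring^'m^'m \<Rightarrow> bool"
  where "star_unitary U \<longleftrightarrow> adj U ** U = mat 1 \<and> U ** adj U = mat 1"

lemma adjoint_mat_eq_adj: "adjoint_mat = adj"
  by (simp add: fun_eq_iff adjoint_mat_def adj_def dq_cnj_eq_cj)

lemma unitary_eq_star_unitary: "unitary = star_unitary"
  by (simp add: fun_eq_iff unitary_def star_unitary_def adjoint_mat_eq_adj)

lemma matrix_mult_nth: "(A ** B) $ i $ j = (\<Sum>k\<in>UNIV. A $ i $ k * B $ k $ j)"
  by (simp add: matrix_matrix_mult_def)

lemma adj_nth [simp]: "adj A $ i $ j = cj (A $ j $ i)"
  by (simp add: adj_def)

lemma adj_adj [simp]: "adj (adj A) = A"
  by (simp add: vec_eq_iff)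

lemma adj_0 [simp]: "adj 0 = 0"
  by (simp add: vec_eq_iff)

lemma adj_mat_1 [simp]: "adj (mat 1) = mat 1"
  by (simp add: vec_eq_iff mat_def)

lemma adj_mult: "adj (A ** B) = adj B ** adj A"
  by (simp add: vec_eq_iff matrix_mult_nth cj_sum cj_mult)

lemma star_unitary_adj: "star_unitary U \<Longrightarrow> star_unitary (adj U)"
  by (simp add: star_unitary_def)

lemma star_unitary_mat_1: "star_unitary (mat 1)"
  by (simp add: star_unitary_def)

lemma star_unitary_mult:
  assumes "star_unitary U" "star_unitary V"
  shows "star_unitary (U ** V)"
proof -
  have "adj V ** adj U ** (U ** V) = adj V ** (adj U ** U) ** V"
    "U ** V ** (adj V ** adj U) = U ** (V ** adj V) ** adj U"
    by (simp_all only: matrix_mul_assoc)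
  with assms show ?thesis
    by (simp add: star_unitary_def adj_mult)
qed

definition frob_sq :: "'a::star_ring^'n^'m \<Rightarrow> 'a"
  where "frob_sq M = (\<Sum>i\<in>UNIV. \<Sum>j\<in>UNIV. M $ i $ j * cj (M $ i $ j))"

lemma frob_sq_adj: "frob_sq (adj M) = frob_sq M"
  unfolding frob_sq_def by (subst sum.swap) (simp add: cj_normal)

lemma frob_sq_unitary_left:
  assumes "star_unitary U"
  shows "frob_sq (U ** M) = frob_sq M"
proof -
  have trace: "frob_sq N = (\<Sum>j\<in>UNIV. (adj N ** N) $ j $ j)" for N :: "'a^'n^'m"
    unfolding frob_sq_def by (subst sum.swap) (simp add: matrix_mult_nth cj_normal)
  have "adj (U ** M) ** (U ** M) = adj M ** (adj U ** U) ** M"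
    by (simp only: adj_mult matrix_mul_assoc)
  also have "\<dots> = adj M ** M"
    using assms by (simp add: star_unitary_def)
  finally show ?thesis
    by (simp add: trace)
qed

text \<open>
  In a noncommutative ring the trace is not cyclic, so invariance on the right is reduced to
  invariance on the left by taking adjoints.
\<close>

lemma frob_sq_unitary_right:
  assumes "star_unitary V"
  shows "frob_sq (M ** V) = frob_sq M"
proof -
  have "frob_sq (M ** V) = frob_sq (adj V ** adj M)"
    by (simp flip: frob_sq_adj[of "M ** V"] add: adj_mult)
  also have "\<dots> = frob_sq M"
    using assms by (simp add: frob_sq_unitary_left star_unitary_adj frob_sq_adj)
  finally show ?thesis .
qed

section \<open>Squared magnitudes and Frobenius norms\<close>

lemma quat_components [simp]:
  "qre 0 = 0" "qi 0 = 0" "qj 0 = 0" "qk 0 = 0"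
  "qre 1 = 1" "qi 1 = 0" "qj 1 = 0" "qk 1 = 0"
  "qre (x + y) = qre x + qre y" "qi (x + y) = qi x + qi y"
  "qj (x + y) = qj x + qj y" "qk (x + y) = qk x + qk y"
  "qre (x - y) = qre x - qre y" "qi (x - y) = qi x - qi y"
  "qj (x - y) = qj x - qj y" "qk (x - y) = qk x - qk y"
  "qre (- x) = - qre x" "qi (- x) = - qi x" "qj (- x) = - qj x" "qk (- x) = - qk x"
  "qre (cj x) = qre x" "qi (cj x) = - qi x" "qj (cj x) = - qj x" "qk (cj x) = - qk x"
  "qre (quat_of_real r) = r" "qi (quat_of_real r) = 0"
  "qj (quat_of_real r) = 0" "qk (quat_of_real r) = 0"
  by (simp_all add: zero_quat_def one_quat_def plus_quat_def minus_quat_def uminus_quat_def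
      cj_quat_def quat_cnj_def quat_of_real_def)

lemma quat_mult_components:
  "qre (x * y) = qre x * qre y - qi x * qi y - qj x * qj y - qk x * qk y"
  "qi (x * y) = qre x * qi y + qi x * qre y + qj x * qk y - qk x * qj y"
  "qj (x * y) = qre x * qj y - qi x * qk y + qj x * qre y + qk x * qi y"
  "qk (x * y) = qre x * qk y + qi x * qj y - qj x * qi y + qk x * qre y"
  by (simp_all add: times_quat_def)

lemma qre_sum: "qre (sum f S) = (\<Sum>i\<in>S. qre (f i))"
  by (induction S rule: infinite_finite_induct) simp_all

definition quat_norm_sq :: "quat \<Rightarrow> real"
  where "quat_norm_sq x = qre (x * cj x)"

lemma quat_norm_sq_eq: "quat_norm_sq x = (qre x)\<^sup>2 + (qi x)\<^sup>2 + (qj x)\<^sup>2 + (qk x)\<^sup>2"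
  by (simp add: quat_norm_sq_def quat_mult_components power2_eq_square)

lemma quat_norm_sq_nonneg [simp]: "0 \<le> quat_norm_sq x"
  by (simp add: quat_norm_sq_eq)

lemma quat_norm_sq_0 [simp]: "quat_norm_sq 0 = 0"
  by (simp add: quat_norm_sq_eq)

lemma quat_norm_sq_eq_0_iff [simp]: "quat_norm_sq x = 0 \<longleftrightarrow> x = 0"
  by (simp add: quat_norm_sq_eq quat_eq_iff add_nonneg_eq_0_iff)

lemma quat_abs_eq: "quat_abs x = sqrt (quat_norm_sq x)"
  by (simp add: quat_abs_def quat_norm_sq_eq)

text \<open>
  The product \<open>x * cj x\<close> is a dual number embedded into the dual quaternions; taking the real
  part of both components recovers it.
\<close>

definition dq_re :: "quat dual \<Rightarrow> real dual"
  where "dq_re x = Dual (qre (std x)) (qre (infi x))"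

definition dq_norm_sq :: "quat dual \<Rightarrow> real dual"
  where "dq_norm_sq x = dq_re (x * cj x)"

lemma dq_re_simps [simp]: "std (dq_re x) = qre (std x)" "infi (dq_re x) = qre (infi x)"
  by (simp_all add: dq_re_def)

lemma dq_of_dual_simps [simp]:
  "std (dq_of_dual r) = quat_of_real (std r)" "infi (dq_of_dual r) = quat_of_real (infi r)"
  by (simp_all add: dq_of_dual_def)

lemma cj_dual_simps [simp]: "std (cj x) = cj (std x)" "infi (cj x) = cj (infi x)"
  for x :: "'a::star_ring dual"
  by (simp_all add: cj_dual_def)

lemma dq_re_sum: "dq_re (sum f S) = (\<Sum>i\<in>S. dq_re (f i))"
  by (simp add: dual_eq_iff std_sum infi_sum qre_sum)

lemma dq_re_1 [simp]: "dq_re 1 = 1"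
  by (simp add: dual_eq_iff)

lemma std_dq_norm_sq: "std (dq_norm_sq x) = quat_norm_sq (std x)"
  by (simp add: dq_norm_sq_def quat_norm_sq_def)

lemma dq_norm_sq_nonneg: "0 \<le> dq_norm_sq x"
proof (cases "std x = 0")
  case True
  then show ?thesis
    by (simp add: dq_norm_sq_def dual_le_iff)
next
  case False
  then have "quat_norm_sq (std x) \<noteq> 0" by simp
  then have "0 < quat_norm_sq (std x)"
    using quat_norm_sq_nonneg[of "std x"] by linarith
  then show ?thesis
    by (simp add: dual_le_iff std_dq_norm_sq)
qed

lemma quat_of_real_commute: "quat_of_real r * x = x * quat_of_real r"
  by (simp add: quat_eq_iff quat_mult_components)

lemma quat_of_real_mult:
  "quat_of_real r * quat_of_real s = quat_of_real (r * s)"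
  "quat_of_real r + quat_of_real s = quat_of_real (r + s)"
  "qre (quat_of_real r * x) = r * qre x"
  by (simp_all add: quat_eq_iff quat_mult_components)

lemma quat_norm_sq_scale: "quat_norm_sq (quat_of_real r * x) = r\<^sup>2 * quat_norm_sq x"
  by (simp add: quat_norm_sq_def quat_mult_components power2_eq_square algebra_simps)

lemma dq_of_dual_commute: "dq_of_dual r * x = x * dq_of_dual r"
  by (simp add: dual_eq_iff quat_of_real_commute add.commute)

lemma dq_norm_sq_scale: "dq_norm_sq (dq_of_dual r * x) = r\<^sup>2 * dq_norm_sq x"
proof -
  have "dq_of_dual r * x * cj (dq_of_dual r * x) = dq_of_dual (r * r) * (x * cj x)"
  proof -
    have "cj (dq_of_dual r) = dq_of_dual r"
      by (simp add: dual_eq_iff quat_eq_iff)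
    moreover have "dq_of_dual (r * r) = dq_of_dual r * dq_of_dual r"
      by (simp add: dual_eq_iff quat_of_real_mult)
    moreover have "R * x * (cj x * R) = R * R * (x * cj x)" if "R = dq_of_dual r" for R
      using dq_of_dual_commute[of r "x * cj x"] that by (simp add: mult.assoc)
    ultimately show ?thesis
      by (simp add: cj_mult)
  qed
  moreover have "dq_re (dq_of_dual s * y) = s * dq_re y" for s y
    by (simp add: dual_eq_iff quat_of_real_mult)
  ultimately show ?thesis
    by (simp add: dq_norm_sq_def power2_eq_square)
qed

lemma dq_norm_sq_of_dual: "dq_norm_sq (dq_of_dual r) = r\<^sup>2"
  using dq_norm_sq_scale[of r 1] by (simp add: dq_norm_sq_def)

text \<open>
  For infinitesimal \<open>x\<close> both sides vanish; the infinitesimal magnitude is invisible in its square.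
\<close>

lemma dq_abs_sq: "(dq_abs x)\<^sup>2 = dq_norm_sq x"
proof (cases "std x = 0")
  case True
  then show ?thesis
    by (simp add: dq_abs_def dq_norm_sq_def dual_eq_iff power2_eq_square)
next
  case False
  then have "quat_norm_sq (std x) \<noteq> 0" by simp
  with False show ?thesis
    by (simp add: dq_abs_def dq_norm_sq_def dual_eq_iff power2_eq_square quat_abs_eq
        quat_norm_sq_def[symmetric] cj_quat_def[symmetric])
qed

lemma frob_norm_eq:
  "frob_norm M =
    (if mat_std M \<noteq> 0 then dual_sqrt (\<Sum>i\<in>UNIV. \<Sum>j\<in>UNIV. dq_norm_sq (M $ i $ j))
     else Dual 0 (sqrt (\<Sum>i\<in>UNIV. \<Sum>j\<in>UNIV. quat_norm_sq (infi (M $ i $ j)))))"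
  by (simp add: frob_norm_def dq_abs_sq quat_frob_norm_def quat_abs_eq mat_infi_def)

lemma dual_vec_norm2_eq:
  "dual_vec_norm2 x =
    (if \<exists>i. std (x $ i) \<noteq> 0 then dual_sqrt (\<Sum>i\<in>UNIV. (x $ i)\<^sup>2)
     else Dual 0 (sqrt (\<Sum>i\<in>UNIV. (infi (x $ i))\<^sup>2)))"
  by (simp add: dual_vec_norm2_def vec_norm2_def frob_norm_eq dq_norm_sq_of_dual mat_std_def
      vec_eq_iff quat_eq_iff quat_norm_sq_eq)

lemma dq_re_frob_sq: "dq_re (frob_sq M) = (\<Sum>i\<in>UNIV. \<Sum>j\<in>UNIV. dq_norm_sq (M $ i $ j))"
  by (simp add: frob_sq_def dq_re_sum dq_norm_sq_def)

lemma qre_frob_sq: "qre (frob_sq M) = (\<Sum>i\<in>UNIV. \<Sum>j\<in>UNIV. quat_norm_sq (M $ i $ j))"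
  by (simp add: frob_sq_def qre_sum quat_norm_sq_def)

lemma unitary_row_col_sums:
  assumes "star_unitary W"
  shows "(\<Sum>j\<in>UNIV. dq_norm_sq (W $ i $ j)) = 1"
    and "(\<Sum>i\<in>UNIV. dq_norm_sq (W $ i $ j)) = 1"
proof -
  have "dq_re ((W ** adj W) $ i $ i) = 1" "dq_re ((adj W ** W) $ j $ j) = 1"
    using assms by (simp_all add: star_unitary_def mat_def)
  then show "(\<Sum>j\<in>UNIV. dq_norm_sq (W $ i $ j)) = 1" "(\<Sum>i\<in>UNIV. dq_norm_sq (W $ i $ j)) = 1"
    by (simp_all add: matrix_mult_nth dq_re_sum dq_norm_sq_def cj_normal)
qed

lemma matrix_mult_diff_left: "(A - B) ** C = A ** C - B ** C"
  for A :: "'a::ring_1^'n^'m"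
  by (simp add: vec_eq_iff matrix_mult_nth left_diff_distrib sum_subtractf)

lemma matrix_mult_diff_right: "A ** (B - C) = A ** B - A ** C"
  for A :: "'a::ring_1^'n^'m"
  by (simp add: vec_eq_iff matrix_mult_nth right_diff_distrib sum_subtractf)

lemma matrix_mult_zero [simp]: "A ** 0 = 0" "0 ** A = 0"
  for A :: "'a::ring_1^'n^'m"
  by (simp_all add: vec_eq_iff matrix_mult_nth)

lemma mat_std_nth [simp]: "mat_std A $ i $ j = std (A $ i $ j)"
  by (simp add: mat_std_def)

lemma mat_infi_nth [simp]: "mat_infi A $ i $ j = infi (A $ i $ j)"
  by (simp add: mat_infi_def)

lemma dual_mat_eq_iff: "A = B \<longleftrightarrow> mat_std A = mat_std B \<and> mat_infi A = mat_infi B"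
  by (auto simp: vec_eq_iff dual_eq_iff)

lemma mat_std_mult: "mat_std (A ** B) = mat_std A ** mat_std B"
  for A :: "'a::ring_1 dual^'n^'m"
  by (simp add: vec_eq_iff matrix_mult_nth std_sum)

lemma mat_infi_mult: "mat_infi (A ** B) = mat_std A ** mat_infi B + mat_infi A ** mat_std B"
  for A :: "'a::ring_1 dual^'n^'m"
  by (simp add: vec_eq_iff matrix_mult_nth infi_sum sum.distrib)

lemma mat_dual_adj: "mat_std (adj A) = adj (mat_std A)" "mat_infi (adj A) = adj (mat_infi A)"
  by (simp_all add: vec_eq_iff)

lemma mat_std_0: "mat_std 0 = 0"
  by (simp add: vec_eq_iff)

lemma mat_dual_mat_1: "mat_std (mat 1) = mat 1" "mat_infi (mat 1) = 0"
  by (simp_all add: vec_eq_iff mat_def)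

lemma star_unitary_mat_std: "star_unitary U \<Longrightarrow> star_unitary (mat_std U)"
  by (auto simp: star_unitary_def mat_std_mult mat_dual_adj mat_dual_mat_1
      dest!: arg_cong[of _ "mat 1" mat_std])

section \<open>The inequality for diagonalized matrices\<close>

lemma conjugated_difference:
  assumes "star_unitary U" "star_unitary V"
    and A: "A = U ** diag_mat l ** adj U" and B: "B = V ** diag_mat m ** adj V"
  shows "(adj U ** (A - B) ** V) $ i $ j = dq_of_dual (l $ i - m $ j) * (adj U ** V) $ i $ j"
proof -
  have "adj U ** A ** V = (adj U ** U) ** diag_mat l ** (adj U ** V)"
    "adj U ** B ** V = (adj U ** V) ** diag_mat m ** (adj V ** V)"
    by (simp_all only: A B matrix_mul_assoc)
  then have "adj U ** (A - B) ** V = diag_mat l ** (adj U ** V) - (adj U ** V) ** diag_mat m"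
    using assms by (simp add: matrix_mult_diff_left matrix_mult_diff_right star_unitary_def)
  moreover have "(diag_mat l ** W) $ i $ j = dq_of_dual (l $ i) * W $ i $ j"
    "(W ** diag_mat m) $ i $ j = dq_of_dual (m $ j) * W $ i $ j" for W
    by (simp_all add: matrix_mult_nth diag_mat_def if_distrib if_distribR dq_of_dual_commute[of "m $ j"]
        cong: if_cong)
  moreover have "dq_of_dual (l $ i - m $ j) = dq_of_dual (l $ i) - dq_of_dual (m $ j)"
    by (simp add: dual_eq_iff quat_eq_iff)
  ultimately show ?thesis
    by (simp add: left_diff_distrib)
qed

lemma dual_sqrt_mono: "p \<le> q \<Longrightarrow> 0 < std p \<Longrightarrow> dual_sqrt p \<le> dual_sqrt q"
  by (auto simp: dual_sqrt_def dual_le_iff divide_right_mono)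

text \<open>
  With \<open>W = U\<^sup>* V\<close>, unitary invariance turns the squared norm of \<open>A - B\<close> into the sum of
  \<open>(l\<^sub>i - m\<^sub>j)\<^sup>2 |w\<^sub>i\<^sub>j|\<^sup>2\<close>, whose weights form a doubly stochastic matrix over the dual numbers.

  This settles the matter unless \<open>A - B\<close> is infinitesimal, when the squares vanish and only
  say that \<open>l\<close> and \<open>m\<close> have the same standard part. In that case the standard part of
  \<open>U\<^sup>* (A - B) V\<close> is zero, so the standard part of \<open>w\<^sub>i\<^sub>j\<close> vanishes unless \<open>l\<^sub>i\<close> and \<open>l\<^sub>j\<close> have
  the same standard part. The real argument is then repeated for the infinitesimal parts: they
  are decreasing only where the standard part is constant, but all the weight sits there.
\<close>

lemma hoffman_wielandt_diagonalized:
  fixes A B :: "quat dual^'m::{finite,linorder}^'m::{finite,linorder}"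
  assumes A: "is_eigenvalue_vector A l" and B: "is_eigenvalue_vector B m"
  shows "dual_vec_norm2 (l - m) \<le> frob_norm (A - B)"
proof -
  obtain U where U: "star_unitary U" and AU: "A = U ** diag_mat l ** adj U"
    using A by (auto simp: is_eigenvalue_vector_def unitary_eq_star_unitary adjoint_mat_eq_adj)
  obtain V where V: "star_unitary V" and BV: "B = V ** diag_mat m ** adj V"
    using B by (auto simp: is_eigenvalue_vector_def unitary_eq_star_unitary adjoint_mat_eq_adj)
  have l: "l $ j \<le> l $ i" and m: "m $ j \<le> m $ i" if "i \<le> j" for i j
    using that A B by (auto simp: is_eigenvalue_vector_def)
  define D where "D = A - B"
  define M where "M = adj U ** D ** V"
  define W where "W = adj U ** V"
  have W: "star_unitary W"
    unfolding W_def using U V by (intro star_unitary_mult star_unitary_adj)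
  have M: "M $ i $ j = dq_of_dual (l $ i - m $ j) * W $ i $ j" for i j
    unfolding M_def D_def W_def by (rule conjugated_difference[OF U V AU BV])
  define S where "S = (\<Sum>i\<in>UNIV. (l $ i - m $ i)\<^sup>2)"
  define T where "T = (\<Sum>i\<in>UNIV. \<Sum>j\<in>UNIV. dq_norm_sq (D $ i $ j))"
  have "frob_sq M = frob_sq D"
    unfolding M_def using U V
    by (simp add: frob_sq_unitary_left frob_sq_unitary_right star_unitary_adj)
  then have "T = (\<Sum>i\<in>UNIV. \<Sum>j\<in>UNIV. dq_norm_sq (M $ i $ j))"
    unfolding T_def by (simp flip: dq_re_frob_sq)
  also have "\<dots> = (\<Sum>i\<in>UNIV. \<Sum>j\<in>UNIV. (l $ i - m $ j)\<^sup>2 * dq_norm_sq (W $ i $ j))"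
    by (simp add: M dq_norm_sq_scale)
  finally have "S \<le> T"
    unfolding S_def
    using doubly_stochastic_diff_squares[of "\<lambda>_. ()" "\<lambda>i. l $ i" "\<lambda>i. m $ i"
        "\<lambda>i j. dq_norm_sq (W $ i $ j)"] l m
    by (simp add: dq_norm_sq_nonneg unitary_row_col_sums[OF W])
  have stdS: "std S = (\<Sum>i\<in>UNIV. (std (l $ i) - std (m $ i))\<^sup>2)"
    by (simp add: S_def std_sum power2_eq_square)
  have stdT: "std T = (\<Sum>i\<in>UNIV. \<Sum>j\<in>UNIV. quat_norm_sq (std (D $ i $ j)))"
    by (simp add: T_def std_sum std_dq_norm_sq)
  show ?thesis
  proof (cases "mat_std D = 0")
    case False
    then have "std T \<noteq> 0"
      by (auto simp: stdT sum_nonneg sum_nonneg_eq_0_iff vec_eq_iff)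
    moreover have "0 \<le> std T"
      by (simp add: stdT sum_nonneg)
    ultimately have T: "0 < std T" by simp
    have norm: "frob_norm (A - B) = dual_sqrt T"
      using False by (simp add: frob_norm_eq T_def D_def)
    show ?thesis
    proof (cases "\<exists>i. std (l $ i) \<noteq> std (m $ i)")
      case True
      then have "std S \<noteq> 0"
        by (auto simp: stdS sum_nonneg_eq_0_iff)
      moreover have "0 \<le> std S"
        by (simp add: stdS sum_nonneg)
      ultimately have "0 < std S" by simp
      with True \<open>S \<le> T\<close> show ?thesis
        by (simp add: norm dual_vec_norm2_eq S_def[symmetric] dual_sqrt_mono)
    next
      case False
      with T show ?thesis
        by (simp add: norm dual_vec_norm2_eq dual_le_iff dual_sqrt_def)
    qed
  next
    case True
    then have D0: "std (D $ i $ j) = 0" for i j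
      by (simp add: vec_eq_iff)
    have "std S \<le> 0"
      using \<open>S \<le> T\<close> by (auto simp: dual_le_iff stdT D0)
    then have "std S = 0"
      by (intro antisym) (simp_all add: stdS sum_nonneg)
    then have std_eq: "std (m $ i) = std (l $ i)" for i
      by (simp add: stdS sum_nonneg_eq_0_iff)
    have "mat_std M = 0" and M1: "mat_infi M = adj (mat_std U) ** mat_infi D ** mat_std V"
      by (simp_all add: M_def mat_std_mult mat_infi_mult mat_dual_adj True)
    then have M0: "std (M $ i $ j) = 0" for i j
      by (metis mat_std_nth zero_index)
    have W0: "std (W $ i $ j) = 0" if "std (l $ i) \<noteq> std (l $ j)" for i j
    proof -
      have "(std (l $ i) - std (l $ j))\<^sup>2 * quat_norm_sq (std (W $ i $ j)) =
          quat_norm_sq (std (M $ i $ j))"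
        by (simp add: M std_eq flip: quat_norm_sq_scale)
      with that show ?thesis
        by (simp add: M0)
    qed
    have "(\<Sum>i\<in>UNIV. (infi (l $ i) - infi (m $ i))\<^sup>2) \<le>
        (\<Sum>i\<in>UNIV. \<Sum>j\<in>UNIV. (infi (l $ i) - infi (m $ j))\<^sup>2 * quat_norm_sq (std (W $ i $ j)))"
    proof (rule doubly_stochastic_diff_squares[where b = "\<lambda>i. std (l $ i)"])
      show "infi (l $ j) \<le> infi (l $ i)" if "i \<le> j" "std (l $ i) = std (l $ j)" for i j
        using l[OF that(1)] that(2) by (simp add: dual_le_iff)
      show "infi (m $ j) \<le> infi (m $ i)" if "i \<le> j" "std (l $ i) = std (l $ j)" for i j
        using m[OF that(1)] that(2) by (simp add: dual_le_iff std_eq)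
      show "(\<Sum>j\<in>UNIV. quat_norm_sq (std (W $ i $ j))) = 1" for i
        using arg_cong[OF unitary_row_col_sums(1)[OF W], of std] by (simp add: std_sum std_dq_norm_sq)
      show "(\<Sum>i\<in>UNIV. quat_norm_sq (std (W $ i $ j))) = 1" for j
        using arg_cong[OF unitary_row_col_sums(2)[OF W], of std] by (simp add: std_sum std_dq_norm_sq)
    qed (simp_all add: W0)
    also have "\<dots> \<le> (\<Sum>i\<in>UNIV. \<Sum>j\<in>UNIV. quat_norm_sq (mat_infi M $ i $ j))"
    proof (intro sum_mono)
      fix i j
      show "(infi (l $ i) - infi (m $ j))\<^sup>2 * quat_norm_sq (std (W $ i $ j))
          \<le> quat_norm_sq (mat_infi M $ i $ j)"
      proof (cases "std (l $ i) = std (l $ j)")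
        case True
        have "quat_of_real 0 = 0"
          by (simp add: quat_eq_iff)
        with True show ?thesis
          by (simp add: M std_eq flip: quat_norm_sq_scale)
      qed (simp add: W0)
    qed
    also have "\<dots> = qre (frob_sq (mat_infi M))"
      by (simp add: qre_frob_sq)
    also have "frob_sq (mat_infi M) = frob_sq (mat_infi D)"
      unfolding M1 using U V
      by (simp add: frob_sq_unitary_left frob_sq_unitary_right star_unitary_adj star_unitary_mat_std)
    finally show ?thesis
      using True by (simp add: dual_vec_norm2_eq frob_norm_eq std_eq dual_le_iff qre_frob_sq D_def)
  qed
qed

lemma eigenvalue_vector_unique:
  fixes A :: "quat dual^'m::{finite,linorder}^'m::{finite,linorder}"
  assumes "is_eigenvalue_vector A l" "is_eigenvalue_vector A m"
  shows "l = m"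
proof -
  have "dual_vec_norm2 (l - m) \<le> 0"
    using hoffman_wielandt_diagonalized[OF assms]
    by (simp add: frob_norm_eq mat_std_0 zero_dual_def)
  moreover have "0 < (\<Sum>i\<in>UNIV. (std (l $ i) - std (m $ i))\<^sup>2)" if "\<exists>i. std (l $ i) \<noteq> std (m $ i)"
    using that by (auto intro!: sum_pos2)
  ultimately have std: "std (l $ i) = std (m $ i)" for i
    by (auto simp: dual_vec_norm2_eq dual_le_iff dual_sqrt_def std_sum power2_eq_square split: if_splits)
  then have "(\<Sum>i\<in>UNIV. (infi (l $ i) - infi (m $ i))\<^sup>2) \<le> 0"
    using \<open>dual_vec_norm2 (l - m) \<le> 0\<close> by (simp add: dual_vec_norm2_eq dual_le_iff)
  then have "(\<Sum>i\<in>UNIV. (infi (l $ i) - infi (m $ i))\<^sup>2) = 0"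
    by (intro antisym sum_nonneg) simp_all
  then show ?thesis
    by (simp add: vec_eq_iff dual_eq_iff std sum_nonneg_eq_0_iff)
qed

section \<open>Plane rotations\<close>

text \<open>
  Identity matrix except for the plane of \<open>i\<close> and \<open>j\<close>, where it has the columns \<open>(x, z)\<close> and
  \<open>(- cj z, x)\<close>.
\<close>

definition rot :: "'m \<Rightarrow> 'm \<Rightarrow> real \<Rightarrow> quat \<Rightarrow> quat^'m^'m"
  where "rot i j x z = (\<chi> r k.
    if k = i then (if r = i then quat_of_real x else if r = j then z else 0)
    else if k = j then (if r = i then - cj z else if r = j then quat_of_real x else 0)
    else if r = k then 1 else 0)"

lemma mult_rot:
  assumes "i \<noteq> j"
  shows "(M ** rot i j x z) $ r $ k =
    (if k = i then M $ r $ i * quat_of_real x + M $ r $ j * z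
     else if k = j then M $ r $ j * quat_of_real x - M $ r $ i * cj z
     else M $ r $ k)"
proof -
  have two: "(\<Sum>s\<in>UNIV. M $ r $ s * (if s = i then p else if s = j then q else 0)) =
      M $ r $ i * p + M $ r $ j * q" for p q
  proof -
    have "(\<Sum>s\<in>UNIV. M $ r $ s * (if s = i then p else if s = j then q else 0)) =
        (\<Sum>s\<in>UNIV. (if s = i then M $ r $ i * p else 0) + (if s = j then M $ r $ j * q else 0))"
      using assms by (intro sum.cong) auto
    then show ?thesis
      by (simp add: sum.distrib)
  qed
  have one: "(\<Sum>s\<in>UNIV. M $ r $ s * (if s = k then 1 else 0)) = M $ r $ k" for k
    by (simp add: if_distrib cong: if_cong)
  show ?thesis
    using assms by (simp add: matrix_mult_nth rot_def two one)
qed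

lemma adj_rot: "i \<noteq> j \<Longrightarrow> adj (rot i j x z) = rot i j x (- z)"
  by (simp add: vec_eq_iff rot_def cj_minus quat_eq_iff)

lemma star_unitary_rot:
  assumes "i \<noteq> j" "x\<^sup>2 + quat_norm_sq z = 1"
  shows "star_unitary (rot i j x z)"
proof -
  have "rot i j x (- z) ** rot i j x z = mat 1" if "x\<^sup>2 + quat_norm_sq z = 1" for z
    using assms(1) that
    by (simp add: vec_eq_iff mult_rot)
      (simp add: rot_def mat_def quat_eq_iff quat_mult_components quat_norm_sq_eq
        power2_eq_square algebra_simps)
  from this[of z] this[of "- z"] assms show ?thesis
    by (simp add: star_unitary_def adj_rot quat_norm_sq_eq)
qed

text \<open>
  The amount by which conjugation with the rotation increases the diagonal entry at \<open>i\<close> of a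
  Hermitian matrix, at the expense of the one at \<open>j\<close>.
\<close>

definition rot_gain :: "quat^'m^'m \<Rightarrow> 'm \<Rightarrow> 'm \<Rightarrow> real \<Rightarrow> quat \<Rightarrow> real"
  where "rot_gain D i j x z =
    quat_norm_sq z * (qre (D $ j $ j) - qre (D $ i $ i)) + 2 * x * qre (D $ i $ j * z)"

lemma diagonal_conj_rot:
  assumes "i \<noteq> j" "x\<^sup>2 + quat_norm_sq z = 1" and D: "adj D = D"
  shows "qre ((adj (rot i j x z) ** D ** rot i j x z) $ k $ k) = qre (D $ k $ k) +
    (if k = i then rot_gain D i j x z else if k = j then - rot_gain D i j x z else 0)"
proof -
  define N where "N = D ** rot i j x z"
  have "(adj (rot i j x z) ** N) $ r $ k = cj ((adj N ** rot i j x z) $ k $ r)" for r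
    by (metis adj_adj adj_mult adj_nth)
  then have "qre ((adj (rot i j x z) ** D ** rot i j x z) $ k $ k) = qre ((adj N ** rot i j x z) $ k $ k)"
    by (simp add: N_def flip: matrix_mul_assoc)
  moreover have herm: "D $ r $ s = cj (D $ s $ r)" for r s
    using D by (metis adj_nth)
  have real: "qi (D $ r $ r) = 0" "qj (D $ r $ r) = 0" "qk (D $ r $ r) = 0" for r
    using arg_cong[OF herm[of r r], of qi] arg_cong[OF herm[of r r], of qj]
      arg_cong[OF herm[of r r], of qk] by simp_all
  have x: "x * x = 1 - (qre z * qre z + qi z * qi z + qj z * qj z + qk z * qk z)"
    using assms(2) by (simp add: quat_norm_sq_eq power2_eq_square)
  have "qre ((adj N ** rot i j x z) $ i $ i) = (x * x) * qre (D $ i $ i)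
      + quat_norm_sq z * qre (D $ j $ j) + 2 * x * qre (D $ i $ j * z)"
    using assms(1) herm[of j i]
    by (simp add: mult_rot N_def quat_mult_components real quat_norm_sq_eq power2_eq_square
        algebra_simps)
  then have "qre ((adj N ** rot i j x z) $ i $ i) = qre (D $ i $ i) + rot_gain D i j x z"
    unfolding x rot_gain_def by (simp add: quat_norm_sq_eq power2_eq_square algebra_simps)
  moreover have "qre ((adj N ** rot i j x z) $ j $ j) = (x * x) * qre (D $ j $ j)
      + quat_norm_sq z * qre (D $ i $ i) - 2 * x * qre (D $ i $ j * z)"
    using assms(1) herm[of j i]
    by (simp add: mult_rot N_def quat_mult_components real quat_norm_sq_eq power2_eq_square
        algebra_simps)
  then have "qre ((adj N ** rot i j x z) $ j $ j) = qre (D $ j $ j) - rot_gain D i j x z"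
    unfolding x rot_gain_def by (simp add: quat_norm_sq_eq power2_eq_square algebra_simps)
  moreover have "qre ((adj N ** rot i j x z) $ k $ k) = qre (D $ k $ k)" if "k \<noteq> i" "k \<noteq> j"
    using assms(1) that by (simp add: mult_rot N_def)
  ultimately show ?thesis
    by simp
qed

text \<open>
  The rotation by a right angle swaps the two diagonal entries, so they must be in order already.
  Let \<open>h = D $ i $ j\<close>, and let \<open>d \<ge> 0\<close> be the difference of the diagonal entries. For
  \<open>(x, z)\<close> proportional to \<open>(d + 1, cj h)\<close>, the loss of \<open>d |h|\<^sup>2\<close> is outweighed by the mixed
  term \<open>2 (d + 1) |h|\<^sup>2\<close>, so the gain is positive unless \<open>h = 0\<close>.
\<close>

lemma no_rot_gain:
  assumes "\<And>x z. x\<^sup>2 + quat_norm_sq z = 1 \<Longrightarrow> rot_gain D i j x z \<le> 0"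
  shows "D $ i $ j = 0" and "qre (D $ j $ j) \<le> qre (D $ i $ i)"
proof -
  have n1: "quat_norm_sq 1 = 1"
    by (simp add: quat_norm_sq_eq)
  then show le: "qre (D $ j $ j) \<le> qre (D $ i $ i)"
    using assms[of 0 1] by (simp add: rot_gain_def)
  define h where "h = D $ i $ j"
  define d where "d = qre (D $ i $ i) - qre (D $ j $ j)"
  define r where "r = sqrt (quat_norm_sq h + (d + 1)\<^sup>2)"
  have "0 \<le> d" using le by (simp add: d_def)
  then have "0 < quat_norm_sq h + (d + 1)\<^sup>2"
    by (intro add_nonneg_pos) simp_all
  then have r: "0 < r" "r\<^sup>2 = quat_norm_sq h + (d + 1)\<^sup>2"
    by (simp_all add: r_def)
  define z where "z = quat_of_real (1 / r) * cj h"
  have "quat_norm_sq (cj h) = quat_norm_sq h"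
    by (simp add: quat_norm_sq_eq)
  then have nz: "quat_norm_sq z = quat_norm_sq h / r\<^sup>2"
    by (simp add: z_def quat_norm_sq_scale power_divide)
  have hz: "qre (h * z) = quat_norm_sq h / r"
    by (simp add: z_def quat_mult_components quat_norm_sq_eq power2_eq_square add_divide_distrib)
  have "((d + 1) / r)\<^sup>2 + quat_norm_sq z = 1"
    using r \<open>0 < quat_norm_sq h + (d + 1)\<^sup>2\<close>
    by (simp add: nz power_divide add_divide_distrib[symmetric] add.commute)
  then have "rot_gain D i j ((d + 1) / r) z \<le> 0"
    by (rule assms)
  also have "rot_gain D i j ((d + 1) / r) z = quat_norm_sq h / r\<^sup>2 * (d + 2)"
    unfolding rot_gain_def h_def[symmetric] hz nz
    by (simp add: d_def power2_eq_square add_divide_distrib diff_divide_distrib algebra_simps)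
  finally have "quat_norm_sq h \<le> 0"
    using r(1) \<open>0 \<le> d\<close> by (auto simp: mult_le_0_iff divide_le_0_iff)
  then have "quat_norm_sq h = 0"
    using quat_norm_sq_nonneg[of h] by linarith
  then show "D $ i $ j = 0"
    by (simp add: h_def)
qed

section \<open>Maximizing over the compact group of quaternion unitary matrices\<close>

text \<open>
  Quaternion matrices get their topology from the Euclidean space of their real coordinates.
\<close>

definition quat_of_tuple :: "real \<times> real \<times> real \<times> real \<Rightarrow> quat"
  where "quat_of_tuple x = Quat (fst x) (fst (snd x)) (fst (snd (snd x))) (snd (snd (snd x)))"

definition mat_of_tuples :: "(real \<times> real \<times> real \<times> real)^'n^'m \<Rightarrow> quat^'n^'m"
  where "mat_of_tuples X = (\<chi> i j. quat_of_tuple (X $ i $ j))"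

definition quat_continuous :: "('a::topological_space \<Rightarrow> quat) \<Rightarrow> bool"
  where "quat_continuous f \<longleftrightarrow>
    continuous_on UNIV (\<lambda>x. qre (f x)) \<and> continuous_on UNIV (\<lambda>x. qi (f x)) \<and>
    continuous_on UNIV (\<lambda>x. qj (f x)) \<and> continuous_on UNIV (\<lambda>x. qk (f x))"

lemma quat_continuous_const: "quat_continuous (\<lambda>_. q)"
  by (simp add: quat_continuous_def)

lemma quat_continuous_cj: "quat_continuous f \<Longrightarrow> quat_continuous (\<lambda>x. cj (f x))"
  by (auto simp: quat_continuous_def intro!: continuous_intros)

lemma quat_continuous_mult:
  "quat_continuous f \<Longrightarrow> quat_continuous g \<Longrightarrow> quat_continuous (\<lambda>x. f x * g x)"
  by (auto simp: quat_continuous_def quat_mult_components intro!: continuous_intros)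

lemma quat_continuous_sum:
  "(\<And>i. i \<in> S \<Longrightarrow> quat_continuous (f i)) \<Longrightarrow> quat_continuous (\<lambda>x. \<Sum>i\<in>S. f i x)"
proof (induction S rule: infinite_finite_induct)
  case (insert i S)
  then show ?case
    by (auto simp: quat_continuous_def intro!: continuous_intros)
qed (simp_all add: quat_continuous_const)

lemma quat_continuous_entry: "quat_continuous (\<lambda>X. mat_of_tuples X $ i $ j)"
  by (auto simp: quat_continuous_def mat_of_tuples_def quat_of_tuple_def intro!: continuous_intros)

lemmas quat_continuous_intros =
  quat_continuous_const quat_continuous_cj quat_continuous_mult quat_continuous_sum
  quat_continuous_entry

lemma closed_quat_eq:
  assumes "quat_continuous f"
  shows "closed {x. f x = c}"
proof -
  have "closed {x. qre (f x) = qre c \<and> qi (f x) = qi c \<and> qj (f x) = qj c \<and> qk (f x) = qk c}"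
    using assms
    by (intro closed_Collect_conj closed_Collect_eq) (auto simp: quat_continuous_def)
  then show ?thesis
    by (simp add: quat_eq_iff)
qed

lemma norm_tuple: "(norm x)\<^sup>2 = quat_norm_sq (quat_of_tuple x)"
  by (cases x) (simp add: norm_Pair quat_of_tuple_def quat_norm_sq_eq)

lemma norm_vec_le_sum: "norm y \<le> (\<Sum>i\<in>UNIV. norm (y $ i))"
  unfolding norm_vec_def by (rule L2_set_le_sum) simp

lemma compact_unitary: "compact {X. star_unitary (mat_of_tuples X)}"
proof -
  let ?K = "{X :: (real \<times> real \<times> real \<times> real)^'m^'m. star_unitary (mat_of_tuples X)}"
  have "closed {X :: (real \<times> real \<times> real \<times> real)^'m^'m.
      \<forall>i j. (adj (mat_of_tuples X) ** mat_of_tuples X) $ i $ j = mat 1 $ i $ j \<and>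
        (mat_of_tuples X ** adj (mat_of_tuples X)) $ i $ j = mat 1 $ i $ j}"
    by (intro closed_Collect_all closed_Collect_conj closed_quat_eq)
      (simp_all add: matrix_mult_nth quat_continuous_intros)
  also have "\<dots> = ?K"
    by (auto simp: star_unitary_def vec_eq_iff)
  finally have "closed ?K" .
  moreover have "norm X \<le> (\<Sum>i\<in>(UNIV::'m set). \<Sum>j\<in>(UNIV::'m set). 1)" if "X \<in> ?K"
    for X :: "(real \<times> real \<times> real \<times> real)^'m^'m"
  proof -
    have "norm (X $ i $ j) \<le> 1" for i j
    proof -
      let ?U = "mat_of_tuples X"
      have "1 = qre ((?U ** adj ?U) $ i $ i)"
        using that by (simp add: star_unitary_def mat_def)
      also have "\<dots> = (\<Sum>j\<in>UNIV. quat_norm_sq (?U $ i $ j))"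
        by (simp add: matrix_mult_nth qre_sum quat_norm_sq_def)
      also have "\<dots> \<ge> quat_norm_sq (?U $ i $ j)"
        by (rule member_le_sum) simp_all
      finally have "(norm (X $ i $ j))\<^sup>2 \<le> 1\<^sup>2"
        by (simp add: norm_tuple mat_of_tuples_def)
      then show ?thesis
        by (rule power2_le_imp_le) simp
    qed
    then have "norm (X $ i) \<le> (\<Sum>j\<in>(UNIV::'m set). 1)" for i
      by (rule order_trans[OF norm_vec_le_sum sum_mono])
    then show ?thesis
      by (rule order_trans[OF norm_vec_le_sum sum_mono])
  qed
  then have "bounded ?K"
    by (rule boundedI)
  ultimately show ?thesis
    by (simp add: compact_eq_bounded_closed)
qed

text \<open>
  For strictly decreasing weights \<open>c\<close> this is increased by every rotation that moves a positive
  amount from a later to an earlier diagonal entry of \<open>adj U ** A ** U\<close>.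
\<close>

definition weighted_trace :: "('m \<Rightarrow> real) \<Rightarrow> quat^'m^'m \<Rightarrow> quat^'m^'m \<Rightarrow> real"
  where "weighted_trace c A U = (\<Sum>k\<in>UNIV. c k * qre ((adj U ** A ** U) $ k $ k))"

lemma weighted_trace_lexicographic_max:
  "\<exists>U. star_unitary U \<and> (\<forall>V. star_unitary V \<longrightarrow>
    weighted_trace c A V \<le> weighted_trace c A U \<and>
    (weighted_trace c A V = weighted_trace c A U \<longrightarrow>
      weighted_trace c B V \<le> weighted_trace c B U))"
proof -
  define K where "K = {X :: (real \<times> real \<times> real \<times> real)^'a^'a. star_unitary (mat_of_tuples X)}"
  have cont: "continuous_on S (\<lambda>X. weighted_trace c M (mat_of_tuples X))" for S M
  proof -
    have "quat_continuous (\<lambda>X. (adj (mat_of_tuples X) ** M ** mat_of_tuples X) $ k $ k)" for k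
      by (simp add: matrix_mult_nth quat_continuous_intros)
    then have "continuous_on UNIV (\<lambda>X. weighted_trace c M (mat_of_tuples X))"
      unfolding weighted_trace_def quat_continuous_def by (intro continuous_intros) blast
    then show ?thesis
      by (rule continuous_on_subset) simp
  qed
  have onto: "\<exists>X. mat_of_tuples X = V" for V :: "quat^'a^'a"
    by (rule exI[of _ "\<chi> i j. (qre (V $ i $ j), qi (V $ i $ j), qj (V $ i $ j), qk (V $ i $ j))"])
      (simp add: vec_eq_iff mat_of_tuples_def quat_of_tuple_def quat_eq_iff)
  have "compact K"
    unfolding K_def by (rule compact_unitary)
  moreover have "K \<noteq> {}"
    using onto[of "mat 1"] star_unitary_mat_1 by (metis K_def empty_iff mem_Collect_eq)
  ultimately obtain X where X: "X \<in> K"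
    and X_max: "\<And>Y. Y \<in> K \<Longrightarrow> weighted_trace c A (mat_of_tuples Y) \<le> weighted_trace c A (mat_of_tuples X)"
    using continuous_attains_sup[OF _ _ cont] by metis
  define L where "L = K \<inter> {Y. weighted_trace c A (mat_of_tuples Y) = weighted_trace c A (mat_of_tuples X)}"
  have "compact L"
    unfolding L_def
    by (intro compact_Int_closed \<open>compact K\<close> closed_Collect_eq cont continuous_on_const)
  moreover have "L \<noteq> {}"
    using X by (auto simp: L_def)
  ultimately obtain Z where Z: "Z \<in> L"
    and Z_max: "\<And>Y. Y \<in> L \<Longrightarrow> weighted_trace c B (mat_of_tuples Y) \<le> weighted_trace c B (mat_of_tuples Z)"
    using continuous_attains_sup[OF _ _ cont] by metis
  show ?thesis
  proof (intro exI[of _ "mat_of_tuples Z"] conjI allI impI)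
    show "star_unitary (mat_of_tuples Z)"
      using Z by (simp add: L_def K_def)
    fix V :: "quat^'a^'a" assume V: "star_unitary V"
    obtain Y where Y: "mat_of_tuples Y = V"
      using onto by blast
    with V have "Y \<in> K"
      by (simp add: K_def)
    with X_max Z Y show "weighted_trace c A V \<le> weighted_trace c A (mat_of_tuples Z)"
      by (auto simp: L_def)
    assume "weighted_trace c A V = weighted_trace c A (mat_of_tuples Z)"
    with \<open>Y \<in> K\<close> Z Y have "Y \<in> L"
      by (auto simp: L_def)
    with Z_max Y show "weighted_trace c B V \<le> weighted_trace c B (mat_of_tuples Z)"
      by auto
  qed
qed

lemma weighted_trace_rot:
  assumes "i \<noteq> j" "x\<^sup>2 + quat_norm_sq z = 1" and A: "adj A = A"
  shows "weighted_trace c A (U ** rot i j x z) =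
    weighted_trace c A U + (c i - c j) * rot_gain (adj U ** A ** U) i j x z"
proof -
  let ?D = "adj U ** A ** U" and ?R = "rot i j x z"
  have "adj ?D = ?D"
    by (simp add: adj_mult A matrix_mul_assoc)
  moreover have "adj (U ** ?R) ** A ** (U ** ?R) = adj ?R ** ?D ** ?R"
    by (simp only: adj_mult matrix_mul_assoc)
  ultimately have "weighted_trace c A (U ** ?R) = (\<Sum>k\<in>UNIV. c k * qre (?D $ k $ k) +
      ((if k = i then c i * rot_gain ?D i j x z else 0) +
       (if k = j then - c j * rot_gain ?D i j x z else 0)))"
    unfolding weighted_trace_def
    using assms(1,2) by (intro sum.cong) (auto simp: diagonal_conj_rot algebra_simps)
  also have "\<dots> = weighted_trace c A U + (c i - c j) * rot_gain ?D i j x z"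
    by (simp only: sum.distrib weighted_trace_def) (simp add: algebra_simps)
  finally show ?thesis .
qed

section \<open>The spectral theorem\<close>

text \<open>
  Let \<open>U\<close> maximize a trace with strictly decreasing weights for \<open>A\<close>, and among these maximizers
  the same trace for \<open>B\<close>. A rotation in the plane of \<open>i < j\<close> cannot increase the trace for \<open>A\<close>,
  so \<open>U\<close> diagonalizes \<open>A\<close>. If the two diagonal entries agree, then the rotation does not change
  the trace for \<open>A\<close> at all, so it cannot increase the trace for \<open>B\<close> either.
\<close>

lemma quaternion_blockwise_diagonalization:
  fixes A B :: "quat^'m::{finite,linorder}^'m::{finite,linorder}"
  assumes A: "adj A = A" and B: "adj B = B"
  obtains U where "star_unitary U"
    and "\<And>i j. i < j \<Longrightarrow> (adj U ** A ** U) $ i $ j = 0"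
    and "\<And>i j. i < j \<Longrightarrow> qre ((adj U ** A ** U) $ j $ j) \<le> qre ((adj U ** A ** U) $ i $ i)"
    and "\<And>i j. i < j \<Longrightarrow> qre ((adj U ** A ** U) $ j $ j) = qre ((adj U ** A ** U) $ i $ i) \<Longrightarrow>
      (adj U ** B ** U) $ i $ j = 0 \<and> qre ((adj U ** B ** U) $ j $ j) \<le> qre ((adj U ** B ** U) $ i $ i)"
proof -
  define c :: "'m \<Rightarrow> real" where "c k = real (card {k..})" for k
  have c: "c j < c i" if "i < j" for i j
    unfolding c_def of_nat_less_iff using that by (intro psubset_card_mono) auto
  obtain U where U: "star_unitary U"
    and max_A: "\<And>V. star_unitary V \<Longrightarrow> weighted_trace c A V \<le> weighted_trace c A U"
    and max_B: "\<And>V. star_unitary V \<Longrightarrow> weighted_trace c A V = weighted_trace c A U \<Longrightarrow>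
      weighted_trace c B V \<le> weighted_trace c B U"
    using weighted_trace_lexicographic_max[of c A B] by blast
  define D where "D = adj U ** A ** U"
  define E where "E = adj U ** B ** U"
  have gain_A: "rot_gain D i j x z \<le> 0" if "i < j" "x\<^sup>2 + quat_norm_sq z = 1" for i j x z
  proof -
    have "(c i - c j) * rot_gain D i j x z \<le> 0"
      using max_A[of "U ** rot i j x z"] U that weighted_trace_rot[OF _ that(2) A, of i j c U]
      by (simp add: star_unitary_mult star_unitary_rot D_def)
    with c[OF that(1)] show ?thesis
      by (simp add: mult_le_0_iff)
  qed
  note D = no_rot_gain[of D, OF gain_A]
  have gain_B: "rot_gain E i j x z \<le> 0"
    if "i < j" "qre (D $ j $ j) = qre (D $ i $ i)" "x\<^sup>2 + quat_norm_sq z = 1" for i j x z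
  proof -
    have "rot_gain D i j x z = 0"
      using that(2) D(1)[OF that(1)] by (simp add: rot_gain_def)
    then have "(c i - c j) * rot_gain E i j x z \<le> 0"
      using max_B[of "U ** rot i j x z"] U that weighted_trace_rot[OF _ that(3) A, of i j c U]
        weighted_trace_rot[OF _ that(3) B, of i j c U]
      by (simp add: star_unitary_mult star_unitary_rot D_def E_def)
    with c[OF that(1)] show ?thesis
      by (simp add: mult_le_0_iff)
  qed
  note E = no_rot_gain[of E, OF gain_B]
  show thesis
    using that[OF U] D E unfolding D_def E_def by blast
qed

text \<open>
  After the previous step, the entries of the infinitesimal part that are still to be removed
  connect different eigenvalues of the standard part. Conjugation with \<open>I + K\<epsilon>\<close>, \<open>K\<close>
  skew-Hermitian, adds the commutator of the standard part with \<open>K\<close> to the infinitesimal part,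
  and solving for \<open>K\<close> only requires division by differences of these eigenvalues.
\<close>

lemma eigenvalue_vector_exists:
  fixes A :: "quat dual^'m::{finite,linorder}^'m::{finite,linorder}"
  assumes "hermitian A"
  shows "\<exists>l. is_eigenvalue_vector A l"
proof -
  have A: "adj A = A"
    using assms by (simp add: hermitian_def adjoint_mat_eq_adj)
  then have "adj (mat_std A) = mat_std A" "adj (mat_infi A) = mat_infi A"
    by (simp_all flip: mat_dual_adj)
  then obtain U where U: "star_unitary U"
    and U0: "\<And>i j. i < j \<Longrightarrow> (adj U ** mat_std A ** U) $ i $ j = 0"
    and dec: "\<And>i j. i < j \<Longrightarrow>
      qre ((adj U ** mat_std A ** U) $ j $ j) \<le> qre ((adj U ** mat_std A ** U) $ i $ i)"
    and U1: "\<And>i j. i < j \<Longrightarrow>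
      qre ((adj U ** mat_std A ** U) $ j $ j) = qre ((adj U ** mat_std A ** U) $ i $ i) \<Longrightarrow>
      (adj U ** mat_infi A ** U) $ i $ j = 0 \<and>
      qre ((adj U ** mat_infi A ** U) $ j $ j) \<le> qre ((adj U ** mat_infi A ** U) $ i $ i)"
    using quaternion_blockwise_diagonalization by blast
  define E where "E = (\<chi> i j. Dual (U $ i $ j) 0)"
  have E01: "mat_std E = U" "mat_infi E = 0"
    by (simp_all add: vec_eq_iff E_def)
  have E: "star_unitary E"
    using U by (simp add: star_unitary_def dual_mat_eq_iff mat_std_mult mat_infi_mult mat_dual_adj
        mat_dual_mat_1 E01)
  define D where "D = adj E ** A ** E"
  define D0 where "D0 = adj U ** mat_std A ** U"
  define D1 where "D1 = adj U ** mat_infi A ** U"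
  have D01: "mat_std D = D0" "mat_infi D = D1"
    by (simp_all add: D_def D0_def D1_def mat_std_mult mat_infi_mult mat_dual_adj E01)
  have "adj D = D"
    by (simp add: D_def adj_mult A matrix_mul_assoc)
  then have "adj D0 = D0" "adj D1 = D1"
    by (simp_all flip: D01 mat_dual_adj)
  then have herm: "cj (D0 $ j $ i) = D0 $ i $ j" "cj (D1 $ j $ i) = D1 $ i $ j" for i j
    by (metis adj_nth)+
  define p where "p i = qre (D0 $ i $ i)" for i
  define q where "q i = qre (D1 $ i $ i)" for i
  have self_cj: "x = quat_of_real (qre x)" if "cj x = x" for x
    using arg_cong[OF that, of qi] arg_cong[OF that, of qj] arg_cong[OF that, of qk]
    by (simp add: quat_eq_iff)
  have diag_D0: "D0 $ i $ j = (if i = j then quat_of_real (p i) else 0)" for i j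
    using U0[of i j] U0[of j i] herm(1)[of j i] self_cj[OF herm(1)[of i i]]
    by (cases i j rule: linorder_cases) (auto simp: p_def D0_def[symmetric])
  have diag_D1: "D1 $ i $ j = (if i = j then quat_of_real (q i) else 0)" if "p i = p j" for i j
    using U1[of i j] U1[of j i] herm(2)[of j i] self_cj[OF herm(2)[of i i]] that
    by (cases i j rule: linorder_cases) (auto simp: p_def q_def D0_def[symmetric] D1_def[symmetric])
  \<comment> \<open>the solution of \<open>D0 ** K - K ** D0 = - D1\<close> outside the blocks of equal \<open>p\<close>\<close>
  define K where
    "K = (\<chi> i j. if p i = p j then 0 else quat_of_real (1 / (p j - p i)) * D1 $ i $ j)"
  have skew: "adj K = - K"
  proof -
    have "cj (K $ j $ i) = - K $ i $ j" for i j
    proof -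
      have "cj (quat_of_real r) = quat_of_real r" for r
        by (simp add: quat_eq_iff)
      moreover have "quat_of_real (1 / (p i - p j)) = - quat_of_real (1 / (p j - p i))"
        by (simp add: quat_eq_iff flip: divide_minus_right)
      ultimately show ?thesis
        by (simp add: K_def cj_mult cj_minus herm quat_of_real_commute[symmetric])
    qed
    then show ?thesis
      by (simp add: vec_eq_iff)
  qed
  define X where "X = (\<chi> i j. Dual (mat 1 $ i $ j) (K $ i $ j))"
  have X01: "mat_std X = mat 1" "mat_infi X = K"
    by (simp_all add: vec_eq_iff X_def)
  have X: "star_unitary X"
    by (simp add: star_unitary_def dual_mat_eq_iff mat_std_mult mat_infi_mult mat_dual_adj
        mat_dual_mat_1 X01 skew)
  define l where "l = (\<chi> i. Dual (p i) (q i))"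
  have l01: "mat_std (diag_mat l) = D0"
    "mat_infi (diag_mat l) = (\<chi> i j. if i = j then quat_of_real (q i) else 0)"
    by (simp_all add: vec_eq_iff diag_mat_def l_def diag_D0)
  have "D ** X = X ** diag_mat l"
  proof -
    have "D0 ** K + D1 = mat_infi (diag_mat l) + K ** D0"
    proof -
      have "quat_of_real (p i) * K $ i $ j + D1 $ i $ j =
          (if i = j then quat_of_real (q i) else 0) + K $ i $ j * quat_of_real (p j)" for i j
      proof (cases "p i = p j")
        case True
        then show ?thesis
          by (simp add: K_def diag_D1)
      next
        case False
        have "quat_of_real (p i) * K $ i $ j + D1 $ i $ j - quat_of_real (p j) * K $ i $ j =
            D1 $ i $ j - quat_of_real (p j - p i) * K $ i $ j"
          by (simp add: quat_eq_iff quat_mult_components algebra_simps)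
        also have "quat_of_real (p j - p i) * K $ i $ j = D1 $ i $ j"
          using False by (simp add: K_def quat_eq_iff quat_mult_components)
        finally show ?thesis
          using False by (auto simp: quat_of_real_commute[of "p j"])
      qed
      moreover have "(D0 ** K) $ i $ j = quat_of_real (p i) * K $ i $ j"
        "(K ** D0) $ i $ j = K $ i $ j * quat_of_real (p j)" for i j
        by (simp_all add: matrix_mult_nth diag_D0 if_distrib if_distribR cong: if_cong)
      ultimately show ?thesis
        by (simp add: vec_eq_iff l01)
    qed
    then show ?thesis
      by (simp add: dual_mat_eq_iff mat_std_mult mat_infi_mult D01 X01 l01)
  qed
  then have "D ** (X ** adj X) = X ** diag_mat l ** adj X"
    by (simp add: matrix_mul_assoc)
  then have D: "D = X ** diag_mat l ** adj X"
    using X by (simp add: star_unitary_def)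
  have "A = (E ** adj E) ** A ** (E ** adj E)"
    using E by (simp add: star_unitary_def)
  also have "\<dots> = E ** D ** adj E"
    by (simp only: D_def matrix_mul_assoc)
  also have "\<dots> = (E ** X) ** diag_mat l ** adj (E ** X)"
    by (simp only: D adj_mult matrix_mul_assoc)
  finally have "A = (E ** X) ** diag_mat l ** adj (E ** X)" .
  moreover have "star_unitary (E ** X)"
    by (rule star_unitary_mult[OF E X])
  moreover have "l $ j \<le> l $ i" if "i \<le> j" for i j
    using dec[of i j] U1[of i j] that
    by (cases "i = j") (auto simp: l_def dual_le_iff p_def q_def D0_def D1_def)
  ultimately show ?thesis
    unfolding is_eigenvalue_vector_def unitary_eq_star_unitary adjoint_mat_eq_adj by blast
qed

lemma is_eigenvalue_vector_eigenvalue_vector: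
  fixes A :: "quat dual^'m::{finite,linorder}^'m::{finite,linorder}"
  assumes "hermitian A"
  shows "is_eigenvalue_vector A (eigenvalue_vector A)"
  unfolding eigenvalue_vector_def
  using eigenvalue_vector_exists[OF assms] eigenvalue_vector_unique by (metis theI)

section \<open>The perturbation inequality\<close>

theorem theorem5p5:
  fixes A B :: "quat dual^'m::{finite,linorder}^'m::{finite,linorder}"
  assumes "hermitian A" and "hermitian B"
  shows "dual_vec_norm2 (eigenvalue_vector A - eigenvalue_vector B) \<le> frob_norm (A - B)"
  using assms by (intro hoffman_wielandt_diagonalized is_eigenvalue_vector_eigenvalue_vector)

end
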